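(* Let $(\mathfrak g,\cdot_{\mathfrak g})$ and $(\mathfrak h,\cdot_{\mathfrak h})$ be pre-Lie algebras and $\phi:\mathfrak g\to\mathfrak h$ a pre-Lie algebra homomorphism. For $k\ge 0$ set $$\mathcal C^k_{\rm preLie}(\phi,\phi)=C^{k+1}_{\rm preLie}(\mathfrak g,\mathfrak g)\oplus C^{k+1}_{\rm preLie}(\mathfrak h,\mathfrak h)\oplus C^{k}_{\rm preLie}(\mathfrak g,\mathfrak h),\qquad C^0_{\rm preLie}(\mathfrak g,\mathfrak h):=0,$$ and define $\delta_{\rm preLie}:\mathcal C^k_{\rm preLie}(\phi,\phi)\to\mathcal C^{k+1}_{\rm preLie}(\phi,\phi)$ by $$\delta_{\rm preLie}(f_1,f_2,f_3)=\big(\mathrm d_{\mathfrak g}f_1,\ \mathrm d_{\mathfrak h}f_2,\ \mathrm d_\phi f_3+(-1)^k(\phi\circ f_1-\phi^*\circ f_2)\big).$$ Then $\delta_{\rm preLie}\circ\delta_{\rm preLie}=0$. Hence $\big(\bigoplus_{k\ge0}\mathcal C^k_{\rm preLie}(\phi,\phi),\delta_{\rm preLie}\big)$ is a cochain complex.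
   Context: All vector spaces are finite dimensional over an algebraically closed field $\mathbb K$ of characteristic $0$. A pre-Lie algebra is a vector space $\mathfrak g$ with a bilinear product $\cdot_{\mathfrak g}$ satisfying $(x\cdot_{\mathfrak g} y)\cdot_{\mathfrak g} z-x\cdot_{\mathfrak g}(y\cdot_{\mathfrak g} z)=(y\cdot_{\mathfrak g} x)\cdot_{\mathfrak g} z-y\cdot_{\mathfrak g}(x\cdot_{\mathfrak g} z)$. Its sub-adjacent Lie algebra $\mathfrak g^c$ has bracket $[x,y]_{\mathfrak g}=x\cdot_{\mathfrak g} y-y\cdot_{\mathfrak g} x$. A homomorphism $\phi$ is a linear map with $\phi(x\cdot_{\mathfrak g}y)=\phi(x)\cdot_{\mathfrak h}\phi(y)$. A representation of $\mathfrak g$ on $V$ is a pair $(\rho,\mu)$ of linear maps $\mathfrak g\to\mathfrak{gl}(V)$ with $\rho$ a representation of $\mathfrak g^c$ and $\rho(x)\mu(y)-\mu(y)\rho(x)=\mu(x\cdot_{\mathfrak g}y)-\mu(y)\mu(x)$. For $n\ge1$ let $C^n_{\rm preLie}(\mathfrak g,V)=\mathrm{Hom}(\wedge^{n-1}\mathfrak g\otimes\mathfrak g,V)$; the coboundary operator $\mathrm d:C^n_{\rm preLie}(\mathfrak g,V)\to C^{n+1}_{\rm preLie}(\mathfrak g,V)$ is $$\begin{aligned}\mathrm df(x_1,\dots,x_{n+1})=&\sum_{i=1}^n(-1)^{i+1}\rho(x_i)f(x_1,\dots,\hat{x_i},\dots,x_{n+1})+\sum_{i=1}^n(-1)^{i+1}\mu(x_{n+1})f(x_1,\dots,\hat{x_i},\dots,x_n,x_i)\\&-\sum_{i=1}^n(-1)^{i+1}f(x_1,\dots,\hat{x_i},\dots,x_n,x_i\cdot_{\mathfrak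 g}x_{n+1})\\&+\sum_{1\le i<j\le n}(-1)^{i+j}f([x_i,x_j]_{\mathfrak g},x_1,\dots,\hat{x_i},\dots,\hat{x_j},\dots,x_{n+1}).\end{aligned}$$ The regular representation of $\mathfrak g$ on itself is $\rho(x)y=x\cdot_{\mathfrak g}y$, $\mu(x)y=y\cdot_{\mathfrak g}x$. Here $\mathrm d_{\mathfrak g},\mathrm d_{\mathfrak h}$ are the coboundary operators of $\mathfrak g,\mathfrak h$ with coefficients in their regular representations, and $\mathrm d_\phi$ is the coboundary operator of $\mathfrak g$ with coefficients in the representation $(\mathfrak h;\rho_\phi,\mu_\phi)$, $\rho_\phi(x)u=\phi(x)\cdot_{\mathfrak h}u$, $\mu_\phi(x)u=u\cdot_{\mathfrak h}\phi(x)$. For $f_1\in C^{k+1}_{\rm preLie}(\mathfrak g,\mathfrak g)$, $f_2\in C^{k+1}_{\rm preLie}(\mathfrak h,\mathfrak h)$, the elements $\phi\circ f_1,\phi^*\circ f_2\in C^{k+1}_{\rm preLie}(\mathfrak g,\mathfrak h)$ are $$(\phi\circ f_1)(x_1,\dots,x_{k+1})=\phi(f_1(x_1,\dots,x_{k+1})),\qquad(\phi^*\circ f_2)(x_1,\dots,x_{k+1})=f_2(\phi(x_1),\dots,\phi(x_{k+1})).$$ *)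

theory Defs
  imports
    "HOL-Computational_Algebra.Polynomial"
    "HOL-Library.Function_Algebras"
    "HOL-Library.Product_Plus"
begin

section \<open>Pre-Lie algebras, homomorphisms and representations\<close>

text \<open>
  All vector spaces are finite dimensional over an algebraically closed field of characteristic 0.
\<close>

locale fin_dim_space = vector_space scale
  for scale :: "'k::{alg_closed_field, field_char_0} \<Rightarrow> 'a::ab_group_add \<Rightarrow> 'a" +
  assumes finite_dimensional: "\<exists>B. finite_dimensional_vector_space scale B"

locale pre_lie_algebra = fin_dim_space scale
  for scale :: "'k::{alg_closed_field, field_char_0} \<Rightarrow> 'a::ab_group_add \<Rightarrow> 'a" +
  fixes mul :: "'a \<Rightarrow> 'a \<Rightarrow> 'a"
  assumes linear_mul_left: "Vector_Spaces.linear scale scale (\<lambda>x. mul x y)"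
    and linear_mul_right: "Vector_Spaces.linear scale scale (\<lambda>y. mul x y)"
    and left_symmetric:
      "mul (mul x y) z - mul x (mul y z) = mul (mul y x) z - mul y (mul x z)"

definition sub_adjacent_bracket :: "('a::ab_group_add \<Rightarrow> 'a \<Rightarrow> 'a) \<Rightarrow> 'a \<Rightarrow> 'a \<Rightarrow> 'a" where
  "sub_adjacent_bracket mul x y = mul x y - mul y x"

locale pre_lie_hom =
  g: pre_lie_algebra scale_g mul_g + h: pre_lie_algebra scale_h mul_h
  for scale_g :: "'k::{alg_closed_field, field_char_0} \<Rightarrow> 'g::ab_group_add \<Rightarrow> 'g"
    and mul_g :: "'g \<Rightarrow> 'g \<Rightarrow> 'g"
    and scale_h :: "'k \<Rightarrow> 'h::ab_group_add \<Rightarrow> 'h"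
    and mul_h :: "'h \<Rightarrow> 'h \<Rightarrow> 'h" +
  fixes \<phi> :: "'g \<Rightarrow> 'h"
  assumes linear_hom: "Vector_Spaces.linear scale_g scale_h \<phi>"
    and hom_mul: "\<phi> (mul_g x y) = mul_h (\<phi> x) (\<phi> y)"

locale pre_lie_representation =
  g: pre_lie_algebra scale_g mul_g + V: fin_dim_space scale_v
  for scale_g :: "'k::{alg_closed_field, field_char_0} \<Rightarrow> 'g::ab_group_add \<Rightarrow> 'g"
    and mul_g :: "'g \<Rightarrow> 'g \<Rightarrow> 'g"
    and scale_v :: "'k \<Rightarrow> 'v::ab_group_add \<Rightarrow> 'v" +
  fixes \<rho> \<mu> :: "'g \<Rightarrow> 'v \<Rightarrow> 'v"
  assumes linear_rho: "Vector_Spaces.linear scale_g scale_v (\<lambda>x. \<rho> x v)"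
    and linear_rho_apply: "Vector_Spaces.linear scale_v scale_v (\<rho> x)"
    and linear_mu: "Vector_Spaces.linear scale_g scale_v (\<lambda>x. \<mu> x v)"
    and linear_mu_apply: "Vector_Spaces.linear scale_v scale_v (\<mu> x)"
    and rho_bracket: "\<rho> (sub_adjacent_bracket mul_g x y) v = \<rho> x (\<rho> y v) - \<rho> y (\<rho> x v)"
    and rho_mu: "\<rho> x (\<mu> y v) - \<mu> y (\<rho> x v) = \<mu> (mul_g x y) v - \<mu> y (\<mu> x v)"

lemma (in pre_lie_hom) pre_lie_representation_hom:
  "pre_lie_representation scale_g mul_g scale_h (\<lambda>x u. mul_h (\<phi> x) u) (\<lambda>x u. mul_h u (\<phi> x))"
proof -
  interpret L: Vector_Spaces.linear scale_g scale_h \<phi> by (rule linear_hom)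
  interpret l: Vector_Spaces.linear scale_h scale_h "\<lambda>x. mul_h x y" for y
    by (rule h.linear_mul_left)
  interpret r: Vector_Spaces.linear scale_h scale_h "\<lambda>y. mul_h x y" for x
    by (rule h.linear_mul_right)
  show ?thesis
  proof unfold_locales
    fix x y :: 'g and v :: 'h
    show "mul_h (\<phi> (sub_adjacent_bracket mul_g x y)) v
        = mul_h (\<phi> x) (mul_h (\<phi> y) v) - mul_h (\<phi> y) (mul_h (\<phi> x) v)"
      using h.left_symmetric[of "\<phi> x" "\<phi> y" v]
      by (simp add: sub_adjacent_bracket_def L.diff l.diff hom_mul algebra_simps)
    show "mul_h (\<phi> x) (mul_h v (\<phi> y)) - mul_h (mul_h (\<phi> x) v) (\<phi> y)
        = mul_h v (\<phi> (mul_g x y)) - mul_h (mul_h v (\<phi> x)) (\<phi> y)"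
      using h.left_symmetric[of "\<phi> x" v "\<phi> y"] by (simp add: hom_mul algebra_simps)
  qed (simp_all add: L.add L.scale l.add l.scale r.add r.scale)
qed

lemma (in pre_lie_algebra) pre_lie_hom_id: "pre_lie_hom scale mul scale mul (\<lambda>x. x)"
  by unfold_locales simp_all

lemma (in pre_lie_algebra) pre_lie_representation_regular:
  "pre_lie_representation scale mul scale (\<lambda>x y. mul x y) (\<lambda>x y. mul y x)"
  by (rule pre_lie_hom.pre_lie_representation_hom[OF pre_lie_hom_id])


section \<open>Cochains and the coboundary operator\<close>

text \<open>
  For \<open>n \<ge> 1\<close>, an element of \<open>Hom(\<And>\<^sup>n\<^sup>-\<^sup>1 g \<otimes> g, V)\<close> is encoded as a multilinear map of \<open>n\<close> arguments
  that is alternating in the first \<open>n - 1\<close> of them. The arguments are passed as a list of length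
  \<open>n\<close>; on lists of any other length the map is required to be 0, so that equality of cochains is
  equality of functions. By convention, the space of \<open>0\<close>-cochains is \<open>0\<close>.
\<close>

definition pre_lie_cochains ::
    "('k::field \<Rightarrow> 'g::ab_group_add \<Rightarrow> 'g) \<Rightarrow> ('k \<Rightarrow> 'v::ab_group_add \<Rightarrow> 'v) \<Rightarrow> nat \<Rightarrow> ('g list \<Rightarrow> 'v) set" where
  "pre_lie_cochains scale_g scale_v n =
     (if n = 0 then {0} else
       {f. (\<forall>xs. length xs \<noteq> n \<longrightarrow> f xs = 0) \<and>
           (\<forall>xs i. length xs = n \<and> i < n \<longrightarrow>
              Vector_Spaces.linear scale_g scale_v (\<lambda>x. f (xs[i := x]))) \<and>
           (\<forall>xs i j. length xs = n \<and> i < j \<and> j < n - 1 \<and> xs ! i = xs ! j \<longrightarrow> f xs = 0)})"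

text \<open>
  The list \<open>xs\<close> has entries \<open>x\<^sub>1, \<dots>, x\<^sub>n\<^sub>+\<^sub>1\<close>, with \<open>x\<^sub>i\<^sub>+\<^sub>1 = xs ! i\<close>; as indices start at 0, the sign
  \<open>(-1)\<^sup>i\<^sup>+\<^sup>1\<close> of the usual formula becomes \<open>(-1)\<^sup>i\<close>, whereas \<open>(-1)\<^sup>i\<^sup>+\<^sup>j\<close> is unchanged. The term
  \<open>nths xs (- I)\<close> is \<open>xs\<close> with the entries at the positions in \<open>I\<close> omitted. For \<open>f = 0\<close> and \<open>n = 0\<close>
  this is the zero map from \<open>0\<close>-cochains to \<open>1\<close>-cochains.
\<close>

definition pre_lie_coboundary ::
    "('k::field \<Rightarrow> 'v::ab_group_add \<Rightarrow> 'v) \<Rightarrow> ('g::ab_group_add \<Rightarrow> 'g \<Rightarrow> 'g) \<Rightarrow>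
     ('g \<Rightarrow> 'v \<Rightarrow> 'v) \<Rightarrow> ('g \<Rightarrow> 'v \<Rightarrow> 'v) \<Rightarrow> nat \<Rightarrow> ('g list \<Rightarrow> 'v) \<Rightarrow> 'g list \<Rightarrow> 'v" where
  "pre_lie_coboundary scale_v mul \<rho> \<mu> n f xs =
     (if length xs = n + 1 then
        (\<Sum>i<n. scale_v ((-1) ^ i) (\<rho> (xs ! i) (f (nths xs (- {i})))))
      + (\<Sum>i<n. scale_v ((-1) ^ i) (\<mu> (xs ! n) (f (nths xs (- {i, n}) @ [xs ! i]))))
      - (\<Sum>i<n. scale_v ((-1) ^ i) (f (nths xs (- {i, n}) @ [mul (xs ! i) (xs ! n)])))
      + (\<Sum>(i, j) \<in> {(i, j). i < j \<and> j < n}. scale_v ((-1) ^ (i + j))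
           (f (sub_adjacent_bracket mul (xs ! i) (xs ! j) # nths xs (- {i, j}))))
      else 0)"


section \<open>The complex of a pre-Lie algebra homomorphism\<close>

definition scale_fun :: "('k \<Rightarrow> 'v \<Rightarrow> 'v) \<Rightarrow> 'k \<Rightarrow> ('a \<Rightarrow> 'v) \<Rightarrow> 'a \<Rightarrow> 'v" where
  "scale_fun scale c f = (\<lambda>x. scale c (f x))"

definition scale_hom_cochains ::
    "('k \<Rightarrow> 'g \<Rightarrow> 'g) \<Rightarrow> ('k \<Rightarrow> 'h \<Rightarrow> 'h) \<Rightarrow> 'k \<Rightarrow>
     ('g list \<Rightarrow> 'g) \<times> ('h list \<Rightarrow> 'h) \<times> ('g list \<Rightarrow> 'h) \<Rightarrow>
     ('g list \<Rightarrow> 'g) \<times> ('h list \<Rightarrow> 'h) \<times> ('g list \<Rightarrow> 'h)" where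
  "scale_hom_cochains scale_g scale_h c =
     (\<lambda>(f\<^sub>1, f\<^sub>2, f\<^sub>3). (scale_fun scale_g c f\<^sub>1, scale_fun scale_h c f\<^sub>2, scale_fun scale_h c f\<^sub>3))"

definition hom_cochains ::
    "('k::field \<Rightarrow> 'g::ab_group_add \<Rightarrow> 'g) \<Rightarrow> ('k \<Rightarrow> 'h::ab_group_add \<Rightarrow> 'h) \<Rightarrow> nat \<Rightarrow>
     (('g list \<Rightarrow> 'g) \<times> ('h list \<Rightarrow> 'h) \<times> ('g list \<Rightarrow> 'h)) set" where
  "hom_cochains scale_g scale_h k =
     pre_lie_cochains scale_g scale_g (k + 1) \<times>
     pre_lie_cochains scale_h scale_h (k + 1) \<times>
     pre_lie_cochains scale_g scale_h k"

definition hom_coboundary ::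
    "('k::field \<Rightarrow> 'g::ab_group_add \<Rightarrow> 'g) \<Rightarrow> ('g \<Rightarrow> 'g \<Rightarrow> 'g) \<Rightarrow>
     ('k \<Rightarrow> 'h::ab_group_add \<Rightarrow> 'h) \<Rightarrow> ('h \<Rightarrow> 'h \<Rightarrow> 'h) \<Rightarrow> ('g \<Rightarrow> 'h) \<Rightarrow> nat \<Rightarrow>
     ('g list \<Rightarrow> 'g) \<times> ('h list \<Rightarrow> 'h) \<times> ('g list \<Rightarrow> 'h) \<Rightarrow>
     ('g list \<Rightarrow> 'g) \<times> ('h list \<Rightarrow> 'h) \<times> ('g list \<Rightarrow> 'h)" where
  "hom_coboundary scale_g mul_g scale_h mul_h \<phi> k = (\<lambda>(f\<^sub>1, f\<^sub>2, f\<^sub>3).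
     (pre_lie_coboundary scale_g mul_g (\<lambda>x y. mul_g x y) (\<lambda>x y. mul_g y x) (k + 1) f\<^sub>1,
      pre_lie_coboundary scale_h mul_h (\<lambda>x y. mul_h x y) (\<lambda>x y. mul_h y x) (k + 1) f\<^sub>2,
      pre_lie_coboundary scale_h mul_g (\<lambda>x u. mul_h (\<phi> x) u) (\<lambda>x u. mul_h u (\<phi> x)) k f\<^sub>3
        + scale_fun scale_h ((-1) ^ k) ((\<lambda>xs. \<phi> (f\<^sub>1 xs)) - (\<lambda>xs. f\<^sub>2 (map \<phi> xs)))))"

text \<open>
  A cochain complex graded by the natural numbers: the degree \<open>k\<close> part \<open>C k\<close> is a subspace of an
  ambient vector space, and \<open>d k\<close> matters only on \<open>C k\<close>.
\<close>

locale cochain_complex = vector_space scale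
  for scale :: "'k::field \<Rightarrow> 'a::ab_group_add \<Rightarrow> 'a" +
  fixes C :: "nat \<Rightarrow> 'a set" and d :: "nat \<Rightarrow> 'a \<Rightarrow> 'a"
  assumes subspace_cochains: "subspace (C k)"
    and diff_in: "x \<in> C k \<Longrightarrow> d k x \<in> C (Suc k)"
    and diff_add: "x \<in> C k \<Longrightarrow> y \<in> C k \<Longrightarrow> d k (x + y) = d k x + d k y"
    and diff_scale: "x \<in> C k \<Longrightarrow> d k (scale a x) = scale a (d k x)"
    and diff_diff: "x \<in> C k \<Longrightarrow> d (Suc k) (d k x) = 0"

end

theory Submission
  imports Defs
begin

text \<open>
  Once the pre-Lie coboundary of an arbitrary representation is known to square to zero, the
  theorem is formal: composing with \<open>\<phi>\<close> on the left carries the coboundary of \<open>g\<close> to \<open>d\<^sub>\<phi>\<close>, composing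
  on the right carries that of \<open>h\<close> to \<open>d\<^sub>\<phi>\<close>, and the two mixed terms in the third component of
  \<open>\<delta>\<delta>\<close> cancel because of the alternating sign \<open>(-1)\<^sup>k\<close>.

  That \<open>d\<^sup>2 = 0\<close> is reduced to Lie algebra cohomology. An element of \<open>Hom(\<And>\<^sup>n\<^sup>-\<^sup>1 g \<otimes> g, V)\<close> is a
  cochain on \<open>g\<close> of degree \<open>n - 1\<close> with values in \<open>Hom(g, V)\<close>. The space \<open>Hom(g, V)\<close> is a module
  over the sub-adjacent Lie algebra under
  \<open>(x A)(y) = \<rho>(x)(A y) + \<mu>(y)(A x) - A(x y)\<close>, and the pre-Lie coboundary is exactly the
  Chevalley--Eilenberg differential for this module (\<open>curry_last_coboundary\<close>).

  To see that the Chevalley--Eilenberg differential \<open>d\<close> squares to zero, write \<open>i\<^sub>x\<close> for the insertion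
  of \<open>x\<close> as first argument and \<open>L\<^sub>x\<close> for the Lie derivative. Since a map on lists is
  determined by its value on the empty list and by its insertions, the identities
  \<open>i\<^sub>y L\<^sub>x = L\<^sub>x i\<^sub>y - i\<^bsub>[x,y]\<^esub>\<close> and Cartan's formula \<open>i\<^sub>x d = L\<^sub>x - d i\<^sub>x\<close> can serve as recursive
  definitions of \<open>L\<^sub>x\<close> and \<open>d\<close> along the list of arguments. Then \<open>[L\<^sub>x, L\<^sub>y] = L\<^bsub>[x,y]\<^esub>\<close>,
  \<open>L\<^sub>x d = d L\<^sub>x\<close> and \<open>d d = 0\<close> follow one from the other, each by induction on that list and
  without double sums with signs, and in the same way \<open>d\<close> is seen to preserve multilinear and
  alternating maps. The usual formula is recovered in \<open>differential_eq_sum\<close>, where the alternating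
  property brings the bracket to the front.
\<close>

section \<open>Lists with omitted entries and sums over pairs\<close>

lemma nths_Cons_omit:
  "nths (x # xs) (- {0}) = xs"
  "nths (x # xs) (- {Suc i}) = x # nths xs (- {i})"
  "nths (x # xs) (- {0, Suc j}) = nths xs (- {j})"
  "nths (x # xs) (- {Suc i, Suc j}) = x # nths xs (- {i, j})"
proof -
  have "{j. Suc j \<in> - {0}} = UNIV" "{j. Suc j \<in> - {Suc i}} = - {i}"
    "{k. Suc k \<in> - {0, Suc j}} = - {j}" "{k. Suc k \<in> - {Suc i, Suc j}} = - {i, j}" by auto
  then show "nths (x # xs) (- {0}) = xs"
    "nths (x # xs) (- {Suc i}) = x # nths xs (- {i})"
    "nths (x # xs) (- {0, Suc j}) = nths xs (- {j})"
    "nths (x # xs) (- {Suc i, Suc j}) = x # nths xs (- {i, j})"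
    by (simp_all add: nths_Cons nths_all)
qed

lemma sum_pairs_Suc:
  fixes F :: "nat \<Rightarrow> nat \<Rightarrow> 'w::comm_monoid_add"
  shows "(\<Sum>(i, j) \<in> {(i, j). i < j \<and> j < Suc n}. F i j)
    = (\<Sum>j<n. F 0 (Suc j)) + (\<Sum>(i, j) \<in> {(i, j). i < j \<and> j < n}. F (Suc i) (Suc j))"
proof -
  have eq: "{(i, j). i < j \<and> j < m} = (SIGMA i:{..<m}. {i<..<m})" for m :: nat by auto
  have "x \<in> {0<..<Suc n} \<longleftrightarrow> x \<in> Suc ` {..<n}" "x \<in> {Suc i<..<Suc n} \<longleftrightarrow> x \<in> Suc ` {i<..<n}" for x i
    by (cases x; auto)+
  then have "{0<..<Suc n} = Suc ` {..<n}" "\<And>i. {Suc i<..<Suc n} = Suc ` {i<..<n}" by blast+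
  then show ?thesis
    unfolding eq by (simp add: sum.Sigma[symmetric] sum.lessThan_Suc_shift sum.reindex
        del: sum.lessThan_Suc)
qed

section \<open>The Chevalley--Eilenberg differential through Cartan's formula\<close>

text \<open>
  Coefficients are confined to a subspace \<open>W\<close>: the action on \<open>Hom(g, V)\<close> is written down for all
  functions from \<open>g\<close> to \<open>V\<close>, but it is linear in the Lie algebra and respects the bracket only on the
  linear ones.
\<close>

locale lie_module = g: vector_space scale_g + w: vector_space scale_w
  for scale_g :: "'k::field \<Rightarrow> 'g::ab_group_add \<Rightarrow> 'g"
    and scale_w :: "'k \<Rightarrow> 'w::ab_group_add \<Rightarrow> 'w" +
  fixes bracket :: "'g \<Rightarrow> 'g \<Rightarrow> 'g" and act :: "'g \<Rightarrow> 'w \<Rightarrow> 'w" and W :: "'w set"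
  assumes bracket_lincomb_left:
      "bracket (scale_g c x + y) z = scale_g c (bracket x z) + bracket y z"
    and bracket_lincomb_right:
      "bracket z (scale_g c x + y) = scale_g c (bracket z x) + bracket z y"
    and bracket_self: "bracket x x = 0"
    and jacobi: "bracket x (bracket y z) = bracket (bracket x y) z + bracket y (bracket x z)"
    and subspace_W: "w.subspace W"
    and act_closed: "A \<in> W \<Longrightarrow> act x A \<in> W"
    and act_lincomb: "act x (scale_w c A + B) = scale_w c (act x A) + act x B"
    and act_lincomb_left:
      "A \<in> W \<Longrightarrow> act (scale_g c x + y) A = scale_w c (act x A) + act y A"
    and act_bracket: "A \<in> W \<Longrightarrow> act (bracket x y) A = act x (act y A) - act y (act x A)"
begin

text \<open>
  A function on lists carries one map for every number of arguments; neither multilinearity nor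
  the alternating property mentions a degree, so both are inherited by insertions.
\<close>

definition multilinear :: "('g list \<Rightarrow> 'w) \<Rightarrow> bool" where
  "multilinear f \<longleftrightarrow> (\<forall>xs. f xs \<in> W) \<and>
     (\<forall>us vs c a b. f (us @ (scale_g c a + b) # vs) = scale_w c (f (us @ a # vs)) + f (us @ b # vs))"

text \<open>
  Only repetitions in neighbouring positions are considered, which is the form that inductions along
  the list preserve; \<open>alternating_distant\<close> extends it to arbitrary positions.
\<close>

definition alternating :: "('g list \<Rightarrow> 'w) \<Rightarrow> bool" where
  "alternating f \<longleftrightarrow> (\<forall>us vs x. f (us @ x # x # vs) = 0)"

text \<open>
  The second equation is \<open>i\<^sub>y L\<^sub>x = L\<^sub>x i\<^sub>y - i\<^bsub>[x,y]\<^esub>\<close>. Unfolded, it gives the usual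
  \<open>(L\<^sub>x f)(y\<^sub>1, \<dots>, y\<^sub>n) = x f(y\<^sub>1, \<dots>, y\<^sub>n) - \<Sum>\<^sub>i f(y\<^sub>1, \<dots>, [x, y\<^sub>i], \<dots>, y\<^sub>n)\<close>.
\<close>

fun lie_derivative :: "'g \<Rightarrow> ('g list \<Rightarrow> 'w) \<Rightarrow> 'g list \<Rightarrow> 'w" where
  "lie_derivative x f [] = act x (f [])"
| "lie_derivative x f (y # ys) = lie_derivative x (\<lambda>zs. f (y # zs)) ys - f (bracket x y # ys)"

text \<open>The second equation is Cartan's formula \<open>i\<^sub>x d = L\<^sub>x - d i\<^sub>x\<close>.\<close>

fun differential :: "('g list \<Rightarrow> 'w) \<Rightarrow> 'g list \<Rightarrow> 'w" where
  "differential f [] = 0"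
| "differential f (x # xs) = lie_derivative x f xs - differential (\<lambda>zs. f (x # zs)) xs"

lemma multilinear_contract: "multilinear f \<Longrightarrow> multilinear (\<lambda>zs. f (x # zs))"
  unfolding multilinear_def by (metis append_Cons)

lemma alternating_contract: "alternating f \<Longrightarrow> alternating (\<lambda>zs. f (x # zs))"
  unfolding alternating_def by (metis append_Cons)

lemma multilinear_in_W: "multilinear f \<Longrightarrow> f xs \<in> W"
  by (simp add: multilinear_def)

lemma multilinear_lincomb:
  "multilinear f \<Longrightarrow> f (us @ (scale_g c a + b) # vs) = scale_w c (f (us @ a # vs)) + f (us @ b # vs)"
  by (simp add: multilinear_def)

lemma multilinear_lincomb_hd:
  "multilinear f \<Longrightarrow> f ((scale_g c a + b) # vs) = scale_w c (f (a # vs)) + f (b # vs)"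
  using multilinear_lincomb[of f "[]"] by simp

lemma multilinear_add:
  "multilinear f \<Longrightarrow> f (us @ (a + b) # vs) = f (us @ a # vs) + f (us @ b # vs)"
  using multilinear_lincomb[of f us 1 a b vs] by simp

lemma multilinear_zero: "multilinear f \<Longrightarrow> f (us @ 0 # vs) = 0"
  using multilinear_add[of f us 0 0 vs] by simp

text \<open>Polarisation: expand \<open>f\<close> at \<open>a + b\<close> repeated in both positions.\<close>

lemma alternating_swap:
  assumes "multilinear f" "alternating f"
  shows "f (us @ a # b # vs) = - f (us @ b # a # vs)"
proof -
  have z: "f (us @ x # x # vs) = 0" for x
    using assms(2) by (simp add: alternating_def)
  have "f (us @ (a + b) # (a + b) # vs) = f (us @ a # (a + b) # vs) + f (us @ b # (a + b) # vs)"
    by (rule multilinear_add[OF assms(1)])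
  also have "\<dots> = f (us @ a # b # vs) + f (us @ b # a # vs)"
    using multilinear_add[OF assms(1), of "us @ [a]" a b vs]
      multilinear_add[OF assms(1), of "us @ [b]" a b vs] by (simp add: z)
  finally show ?thesis by (simp add: z eq_neg_iff_add_eq_0)
qed

text \<open>Neighbour swaps move the first \<open>a\<close> towards the second until they meet.\<close>

lemma alternating_distant:
  assumes "multilinear f" "alternating f"
  shows "f (us @ a # ws @ a # vs) = 0"
proof (induction ws arbitrary: us)
  case Nil
  then show ?case using assms(2) by (simp add: alternating_def)
next
  case (Cons w ws)
  have "f (us @ a # (w # ws) @ a # vs) = - f ((us @ [w]) @ a # ws @ a # vs)"
    using alternating_swap[OF assms, of us a w "ws @ a # vs"] by simp
  then show ?case by (simp only: Cons.IH minus_zero)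
qed

lemma lie_derivative_lincomb:
  "lie_derivative x (\<lambda>zs. scale_w c (f zs) + h zs) ys
     = scale_w c (lie_derivative x f ys) + lie_derivative x h ys"
  by (induction ys arbitrary: f h) (simp_all add: act_lincomb w.scale_right_diff_distrib)

lemma act_zero: "act x 0 = 0"
  using act_lincomb[of x 1 0 0] by simp

lemma lie_derivative_zero: "lie_derivative x (\<lambda>_. 0) ys = 0"
  by (induction ys) (simp_all add: act_zero)

lemma lie_derivative_diff:
  "lie_derivative x (\<lambda>zs. f zs - h zs) ys = lie_derivative x f ys - lie_derivative x h ys"
  using lie_derivative_lincomb[of x "-1" h f ys] by simp

lemma lie_derivative_lincomb_left:
  "multilinear f \<Longrightarrow>
     lie_derivative (scale_g c x + y) f zs = scale_w c (lie_derivative x f zs) + lie_derivative y f zs"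
proof (induction zs arbitrary: f)
  case Nil
  then show ?case by (simp add: act_lincomb_left multilinear_in_W)
next
  case (Cons z zs)
  show ?case
    using Cons.IH[OF multilinear_contract[OF Cons.prems]]
    by (simp add: bracket_lincomb_left multilinear_lincomb_hd[OF Cons.prems] w.scale_right_diff_distrib)
qed

lemma multilinear_lie_derivative:
  assumes "multilinear f"
  shows "multilinear (lie_derivative x f)"
  unfolding multilinear_def
proof (intro conjI allI)
  fix xs
  show "lie_derivative x f xs \<in> W"
    using assms
    by (induction xs arbitrary: f)
      (simp_all add: act_closed multilinear_in_W multilinear_contract w.subspace_diff[OF subspace_W])
next
  fix us vs c a b
  show "lie_derivative x f (us @ (scale_g c a + b) # vs)
      = scale_w c (lie_derivative x f (us @ a # vs)) + lie_derivative x f (us @ b # vs)"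
    using assms
  proof (induction us arbitrary: f)
    case Nil
    then show ?case
      by (simp add: multilinear_lincomb_hd bracket_lincomb_right lie_derivative_lincomb
          w.scale_right_diff_distrib)
  next
    case (Cons u us)
    show ?case
      using Cons.IH[OF multilinear_contract[OF Cons.prems]]
        multilinear_lincomb[OF Cons.prems, of "bracket x u # us"]
      by (simp add: w.scale_right_diff_distrib)
  qed
qed

text \<open>
  At the repeated pair the two terms \<open>f([x,a], a, \<dots>)\<close> and \<open>f(a, [x,a], \<dots>)\<close> cancel by skew symmetry;
  every other term still contains the pair.
\<close>

lemma alternating_lie_derivative:
  assumes "multilinear f" "alternating f"
  shows "alternating (lie_derivative x f)"
  unfolding alternating_def
proof (intro allI)
  fix us vs a
  show "lie_derivative x f (us @ a # a # vs) = 0"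
    using assms
  proof (induction us arbitrary: f)
    case Nil
    have z: "f (a # a # zs) = 0" for zs
      using Nil.prems(2) unfolding alternating_def by (metis append_Nil)
    show ?case
      using alternating_swap[OF Nil.prems, of "[]" "bracket x a" a vs]
      by (simp add: z lie_derivative_zero)
  next
    case (Cons u us)
    have "f ((bracket x u # us) @ a # a # vs) = 0"
      using Cons.prems(2) unfolding alternating_def by metis
    then show ?case
      using Cons.IH[OF multilinear_contract[OF Cons.prems(1)] alternating_contract[OF Cons.prems(2)]]
      by simp
  qed
qed

text \<open>
  After insertion of \<open>z\<close> and use of the induction hypothesis for \<open>i\<^sub>z f\<close>, only terms with a double
  bracket remain, and these match by the Jacobi identity.
\<close>

lemma lie_derivative_commutator:
  "multilinear f \<Longrightarrow>
     lie_derivative x (lie_derivative y f) zs - lie_derivative y (lie_derivative x f) zs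
       = lie_derivative (bracket x y) f zs"
proof (induction zs arbitrary: f)
  case Nil
  then show ?case by (simp add: act_bracket multilinear_in_W)
next
  case (Cons z zs)
  have "f (bracket x (bracket y z) # zs)
      = f (bracket (bracket x y) z # zs) + f (bracket y (bracket x z) # zs)"
    using multilinear_add[OF Cons.prems, of "[]"] by (simp add: jacobi[of x y z])
  then show ?case
    using Cons.IH[OF multilinear_contract[OF Cons.prems], of z]
    by (simp add: lie_derivative_diff algebra_simps)
qed

lemma differential_lincomb:
  "differential (\<lambda>zs. scale_w c (f zs) + h zs) xs
     = scale_w c (differential f xs) + differential h xs"
  by (induction xs arbitrary: f h)
    (simp_all add: lie_derivative_lincomb w.scale_right_diff_distrib)

lemma differential_zero: "differential (\<lambda>_. 0) xs = 0"
  by (induction xs) (simp_all add: lie_derivative_zero)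

lemma differential_diff:
  "differential (\<lambda>zs. f zs - h zs) xs = differential f xs - differential h xs"
  using differential_lincomb[of "-1" h f xs] by simp

lemma multilinear_differential:
  assumes "multilinear f"
  shows "multilinear (differential f)"
  unfolding multilinear_def
proof (intro conjI allI)
  fix xs
  show "differential f xs \<in> W"
    using assms
    by (induction xs arbitrary: f)
      (simp_all add: w.subspace_0[OF subspace_W] multilinear_contract w.subspace_diff[OF subspace_W]
        multilinear_in_W[OF multilinear_lie_derivative])
next
  fix us vs c a b
  show "differential f (us @ (scale_g c a + b) # vs)
      = scale_w c (differential f (us @ a # vs)) + differential f (us @ b # vs)"
    using assms
  proof (induction us arbitrary: f)
    case Nil
    then show ?case
      by (simp add: multilinear_lincomb_hd lie_derivative_lincomb_left differential_lincomb
          w.scale_right_diff_distrib)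
  next
    case (Cons u us)
    show ?case
      using Cons.IH[OF multilinear_contract[OF Cons.prems]]
        multilinear_lincomb[OF multilinear_lie_derivative[OF Cons.prems]]
      by (simp add: w.scale_right_diff_distrib)
  qed
qed

text \<open>
  For a pair at the head, \<open>i\<^sub>a i\<^sub>a d = i\<^sub>a L\<^sub>a - i\<^sub>a d i\<^sub>a = i\<^sub>a L\<^sub>a - L\<^sub>a i\<^sub>a + d i\<^sub>a i\<^sub>a\<close>, which is
  \<open>- i\<^bsub>[a,a]\<^esub> = 0\<close> because \<open>i\<^sub>a i\<^sub>a f = 0\<close>.
\<close>

lemma alternating_differential:
  assumes "multilinear f" "alternating f"
  shows "alternating (differential f)"
  unfolding alternating_def
proof (intro allI)
  fix us vs a
  show "differential f (us @ a # a # vs) = 0"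
    using assms
  proof (induction us arbitrary: f)
    case Nil
    have z: "f (a # a # zs) = 0" for zs
      using Nil.prems(2) unfolding alternating_def by (metis append_Nil)
    show ?case
      using multilinear_zero[OF Nil.prems(1), of "[]"]
      by (simp add: z bracket_self differential_zero)
  next
    case (Cons u us)
    have "lie_derivative u f (us @ a # a # vs) = 0"
      using alternating_lie_derivative[OF Cons.prems] by (simp add: alternating_def)
    then show ?case
      using Cons.IH[OF multilinear_contract[OF Cons.prems(1)] alternating_contract[OF Cons.prems(2)]]
      by simp
  qed
qed

text \<open>
  After insertion of \<open>y\<close> and use of the induction hypothesis for \<open>i\<^sub>y f\<close>, the difference of the two
  sides is \<open>[L\<^sub>x, L\<^sub>y] - L\<^bsub>[x,y]\<^esub>\<close>.
\<close>

lemma lie_derivative_differential: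
  "multilinear f \<Longrightarrow> lie_derivative x (differential f) ys = differential (lie_derivative x f) ys"
proof (induction ys arbitrary: f)
  case Nil
  then show ?case by (simp add: act_zero)
next
  case (Cons y ys)
  show ?case
    using Cons.IH[OF multilinear_contract[OF Cons.prems], of y]
      lie_derivative_commutator[OF Cons.prems, of x y ys]
    by (simp add: lie_derivative_diff differential_diff algebra_simps)
qed

text \<open>Here \<open>i\<^sub>x d d = L\<^sub>x d - d i\<^sub>x d = L\<^sub>x d - d L\<^sub>x + d d i\<^sub>x\<close>.\<close>

theorem differential_differential: "multilinear f \<Longrightarrow> differential (differential f) xs = 0"
proof (induction xs arbitrary: f)
  case Nil
  then show ?case by simp
next
  case (Cons x xs)
  show ?case
    using Cons.IH[OF multilinear_contract[OF Cons.prems]]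
      lie_derivative_differential[OF Cons.prems]
    by (simp add: differential_diff)
qed

text \<open>
  The bracket stands at the front here, as in the pre-Lie coboundary; moving it there past
  \<open>j\<close> arguments costs the sign \<open>(-1)\<^sup>j\<close>.
\<close>

lemma lie_derivative_eq_sum:
  assumes "multilinear f" "alternating f"
  shows "lie_derivative x f xs = act x (f xs)
      + (\<Sum>j<length xs. scale_w ((-1) ^ Suc j) (f (bracket x (xs ! j) # nths xs (- {j}))))"
  using assms
proof (induction xs arbitrary: f)
  case Nil
  then show ?case by simp
next
  case (Cons y ys)
  have "f (y # b # zs) = - f (b # y # zs)" for b zs
    using alternating_swap[OF Cons.prems, of "[]" y b zs] by simp
  then show ?case
    using Cons.IH[OF multilinear_contract[OF Cons.prems(1)] alternating_contract[OF Cons.prems(2)]]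
    by (simp add: nths_Cons_omit sum.lessThan_Suc_shift del: sum.lessThan_Suc)
qed

lemma differential_eq_sum:
  assumes "multilinear f" "alternating f"
  shows "differential f xs = (\<Sum>i<length xs. scale_w ((-1) ^ i) (act (xs ! i) (f (nths xs (- {i})))))
      + (\<Sum>(i, j) \<in> {(i, j). i < j \<and> j < length xs}. scale_w ((-1) ^ (i + j))
           (f (bracket (xs ! i) (xs ! j) # nths xs (- {i, j}))))"
  using assms
proof (induction xs arbitrary: f)
  case Nil
  then show ?case by simp
next
  case (Cons x xs)
  have swap: "f (x # b # zs) = - f (b # x # zs)" for b zs
    using alternating_swap[OF Cons.prems, of "[]" x b zs] by simp
  show ?case
    using Cons.IH[OF multilinear_contract[OF Cons.prems(1)] alternating_contract[OF Cons.prems(2)], of x]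
    unfolding length_Cons sum_pairs_Suc
    by (simp add: nths_Cons_omit sum.lessThan_Suc_shift lie_derivative_eq_sum[OF Cons.prems]
        swap sum_negf case_prod_unfold del: sum.lessThan_Suc)
qed

text \<open>
  On lists of a given length the Lie derivative and the differential depend only on the values
  of \<open>f\<close> on lists of one particular length. Hence they keep the property of vanishing off one degree.
\<close>

lemma lie_derivative_cong_zero:
  "(\<And>ys. length ys = length xs \<Longrightarrow> f ys = 0) \<Longrightarrow> lie_derivative x f xs = 0"
  by (induction xs arbitrary: f) (simp_all add: act_zero)

lemma differential_cong_zero:
  "(\<And>ys. Suc (length ys) = length xs \<Longrightarrow> f ys = 0) \<Longrightarrow> differential f xs = 0"
  by (induction xs arbitrary: f) (simp_all add: lie_derivative_cong_zero)

end

section \<open>Spaces of cochains\<close>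

lemma vector_space_scale_fun:
  assumes "vector_space s"
  shows "vector_space (scale_fun s)"
proof -
  interpret vector_space s by (rule assms)
  show ?thesis
    by unfold_locales
      (auto simp: scale_fun_def fun_eq_iff scale_right_distrib scale_left_distrib)
qed

lemma linear_zero_map:
  assumes "vector_space s" "vector_space t"
  shows "Vector_Spaces.linear s t (\<lambda>_. 0)"
proof -
  interpret t: vector_space t by (rule assms)
  show ?thesis using assms by (simp add: Vector_Spaces.linear_iff)
qed

lemma linear_lincomb_maps:
  assumes "Vector_Spaces.linear s t f" "Vector_Spaces.linear s t h"
  shows "Vector_Spaces.linear s t (\<lambda>x. t c (f x) + h x)"
proof -
  interpret f: Vector_Spaces.linear s t f by (rule assms)
  interpret h: Vector_Spaces.linear s t h by (rule assms)
  show ?thesis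
    unfolding Vector_Spaces.linear_iff
    using f.vs1.vector_space_axioms f.vs2.vector_space_axioms
    by (simp add: f.add h.add f.scale h.scale f.vs2.scale_right_distrib ac_simps)
qed

text \<open>
  Additivity and homogeneity are treated together as compatibility with \<open>c f + h\<close>; the two
  laws are its cases \<open>c = 1\<close> and \<open>h = 0\<close>.
\<close>

lemma pre_lie_cochains_lincomb:
  assumes "f \<in> pre_lie_cochains s t n" "h \<in> pre_lie_cochains s t n" "vector_space t"
  shows "scale_fun t c f + h \<in> pre_lie_cochains s t n"
proof -
  interpret vector_space t by (rule assms)
  show ?thesis
    using assms(1,2) unfolding pre_lie_cochains_def
    by (auto simp: scale_fun_def fun_eq_iff split: if_splits intro!: linear_lincomb_maps)
qed

lemma zero_in_pre_lie_cochains: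
  assumes "vector_space s" "vector_space t"
  shows "0 \<in> pre_lie_cochains s t n"
  using linear_zero_map[OF assms] by (simp add: pre_lie_cochains_def)

lemma subspace_pre_lie_cochains:
  assumes "vector_space s" "vector_space t"
  shows "module.subspace (scale_fun t) (pre_lie_cochains s t n)"
proof -
  interpret F: vector_space "scale_fun t"
    by (rule vector_space_scale_fun[OF assms(2)])
  note c = pre_lie_cochains_lincomb[OF _ _ assms(2), of _ s n]
  show ?thesis
  proof (rule F.subspaceI)
    show z: "0 \<in> pre_lie_cochains s t n"
      by (rule zero_in_pre_lie_cochains[OF assms])
    show "f + h \<in> pre_lie_cochains s t n"
      if "f \<in> pre_lie_cochains s t n" "h \<in> pre_lie_cochains s t n" for f h
      using c[OF that, of 1] by simp
    show "scale_fun t a f \<in> pre_lie_cochains s t n" if "f \<in> pre_lie_cochains s t n" for a f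
      using c[OF that z, of a] by simp
  qed
qed

lemma pre_lie_cochains_repeated:
  assumes "f \<in> pre_lie_cochains s t n" "i < j" "j < length xs - 1" "xs ! i = xs ! j"
  shows "f xs = 0"
proof (cases "0 < n \<and> length xs = n")
  case True
  then have "\<forall>xs i j. length xs = n \<and> i < j \<and> j < n - 1 \<and> xs ! i = xs ! j \<longrightarrow> f xs = 0"
    using assms(1) by (simp add: pre_lie_cochains_def)
  with True assms(2-4) show ?thesis by blast
next
  case False
  then show ?thesis
    using assms(1) by (auto simp: pre_lie_cochains_def split: if_splits)
qed

lemma pre_lie_cochains_linear_at:
  assumes "f \<in> pre_lie_cochains s t n" "vector_space s" "vector_space t"
  shows "Vector_Spaces.linear s t (\<lambda>x. f (us @ x # vs))"
proof (cases "0 < n \<and> length (us @ 0 # vs) = n")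
  case True
  then have "\<And>xs i. length xs = n \<and> i < n \<Longrightarrow> Vector_Spaces.linear s t (\<lambda>x. f (xs[i := x]))"
    using assms(1) by (simp add: pre_lie_cochains_def)
  from this[of "us @ 0 # vs" "length us"] True show ?thesis by simp
next
  case False
  then have "f (us @ x # vs) = 0" for x
    using assms(1) by (auto simp: pre_lie_cochains_def split: if_splits)
  then show ?thesis using linear_zero_map[OF assms(2,3)] by simp
qed

section \<open>The pre-Lie coboundary as a Chevalley--Eilenberg differential\<close>

definition curry_last :: "('a list \<Rightarrow> 'b) \<Rightarrow> 'a list \<Rightarrow> 'a \<Rightarrow> 'b" where
  "curry_last f xs = (\<lambda>y. f (xs @ [y]))"

text \<open>The value at the empty list is lost by currying, hence the second assumption.\<close>

lemma curry_last_inject: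
  assumes "curry_last f = curry_last h" "f [] = h []"
  shows "f = h"
proof
  fix xs
  show "f xs = h xs"
    using assms by (cases xs rule: rev_cases) (auto simp: curry_last_def fun_eq_iff)
qed

lemma sum_fun_apply: "(\<Sum>i\<in>I. F i) y = (\<Sum>i\<in>I. F i y)"
  by (induction I rule: infinite_finite_induct) simp_all

context pre_lie_representation
begin

text \<open>
  The action of the sub-adjacent Lie algebra on \<open>Hom(g, V)\<close>. The term \<open>\<mu>(y)(A x)\<close> produces the second
  sum of the pre-Lie coboundary, in which \<open>x\<^sub>i\<close> moves to the last argument of the cochain.
\<close>

definition hom_action :: "'g \<Rightarrow> ('g \<Rightarrow> 'v) \<Rightarrow> 'g \<Rightarrow> 'v" where
  "hom_action x A = (\<lambda>y. \<rho> x (A y) + \<mu> y (A x) - A (mul_g x y))"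

text \<open>
  The bracket satisfies the Jacobi identity because the associator is symmetric in its first two
  arguments. For compatibility of the action with the bracket, the terms with \<open>A z\<close> are the
  representation property of \<open>\<rho>\<close>, those with \<open>\<mu>\<close> the compatibility of \<open>\<rho>\<close> and \<open>\<mu>\<close>, and those where \<open>A\<close>
  is applied to a triple product are left symmetry.
\<close>

sublocale CE: lie_module scale_g "scale_fun scale_v" "sub_adjacent_bracket mul_g" hom_action
  "{A. Vector_Spaces.linear scale_g scale_v A}"
proof -
  interpret vf: vector_space "scale_fun scale_v"
    by (rule vector_space_scale_fun[OF V.vector_space_axioms])
  interpret rx: Vector_Spaces.linear scale_g scale_v "\<lambda>x. \<rho> x v" for v by (rule linear_rho)
  interpret rv: Vector_Spaces.linear scale_v scale_v "\<rho> x" for x by (rule linear_rho_apply)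
  interpret mx: Vector_Spaces.linear scale_g scale_v "\<lambda>x. \<mu> x v" for v by (rule linear_mu)
  interpret mv: Vector_Spaces.linear scale_v scale_v "\<mu> x" for x by (rule linear_mu_apply)
  interpret l: Vector_Spaces.linear scale_g scale_g "\<lambda>x. mul_g x y" for y
    by (rule g.linear_mul_left)
  interpret r: Vector_Spaces.linear scale_g scale_g "\<lambda>y. mul_g x y" for x
    by (rule g.linear_mul_right)
  let ?W = "{A. Vector_Spaces.linear scale_g scale_v A}"
  show "lie_module scale_g (scale_fun scale_v) (sub_adjacent_bracket mul_g) hom_action ?W"
  proof unfold_locales
    fix x y z :: 'g and c :: 'k
    show "sub_adjacent_bracket mul_g (scale_g c x + y) z
        = scale_g c (sub_adjacent_bracket mul_g x z) + sub_adjacent_bracket mul_g y z"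
      by (simp add: sub_adjacent_bracket_def l.add l.scale r.add r.scale
          g.scale_right_diff_distrib)
    show "sub_adjacent_bracket mul_g z (scale_g c x + y)
        = scale_g c (sub_adjacent_bracket mul_g z x) + sub_adjacent_bracket mul_g z y"
      by (simp add: sub_adjacent_bracket_def l.add l.scale r.add r.scale
          g.scale_right_diff_distrib)
    show "sub_adjacent_bracket mul_g x x = 0"
      by (simp add: sub_adjacent_bracket_def)
    show "sub_adjacent_bracket mul_g x (sub_adjacent_bracket mul_g y z)
        = sub_adjacent_bracket mul_g (sub_adjacent_bracket mul_g x y) z
          + sub_adjacent_bracket mul_g y (sub_adjacent_bracket mul_g x z)"
      \<comment> \<open>the Jacobi identity is the sum of left symmetry over the cyclic permutations\<close>
      using arg_cong2[where f = "(+)", OF g.left_symmetric[of x y z]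
          arg_cong2[where f = "(+)", OF g.left_symmetric[of y z x] g.left_symmetric[of z x y]]]
      by (simp add: sub_adjacent_bracket_def l.diff r.diff algebra_simps)
  next
    show "vf.subspace ?W"
      by (rule vf.subspaceI)
        (use linear_zero_map[OF g.vector_space_axioms V.vector_space_axioms]
          linear_lincomb_maps[of scale_g scale_v _ _ 1]
          linear_lincomb_maps[of scale_g scale_v _ "\<lambda>_. 0"]
         in \<open>force simp: zero_fun_def plus_fun_def scale_fun_def\<close>)+
  next
    fix x y :: 'g and A B :: "'g \<Rightarrow> 'v" and c :: 'k
    show "hom_action x (scale_fun scale_v c A + B)
        = scale_fun scale_v c (hom_action x A) + hom_action x B"
      by (simp add: hom_action_def scale_fun_def fun_eq_iff rv.add rv.scale mv.add mv.scale
          V.scale_right_distrib V.scale_right_diff_distrib)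
    assume "A \<in> ?W"
    then interpret A: Vector_Spaces.linear scale_g scale_v A by simp
    show "hom_action x A \<in> ?W"
      unfolding mem_Collect_eq Vector_Spaces.linear_iff
      using g.vector_space_axioms V.vector_space_axioms
      by (simp add: hom_action_def A.add A.scale rv.add rv.scale mx.add mx.scale r.add r.scale
          V.scale_right_distrib V.scale_right_diff_distrib)
    show "hom_action (scale_g c x + y) A
        = scale_fun scale_v c (hom_action x A) + hom_action y A"
      by (simp add: hom_action_def scale_fun_def fun_eq_iff A.add A.scale rx.add rx.scale
          mv.add mv.scale l.add l.scale V.scale_right_distrib V.scale_right_diff_distrib)
    show "hom_action (sub_adjacent_bracket mul_g x y) A
        = hom_action x (hom_action y A) - hom_action y (hom_action x A)"
    proof
      fix z
      have ls: "A (mul_g (mul_g x y) z) = A (mul_g x (mul_g y z)) + A (mul_g (mul_g y x) z)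
          - A (mul_g y (mul_g x z))"
        using arg_cong[OF g.left_symmetric[of x y z], of A]
        by (simp add: A.add A.diff algebra_simps)
      have commute: "\<rho> x (\<mu> z (A y)) = \<mu> z (\<rho> x (A y)) + \<mu> (mul_g x z) (A y) - \<mu> z (\<mu> x (A y))"
        "\<rho> y (\<mu> z (A x)) = \<mu> z (\<rho> y (A x)) + \<mu> (mul_g y z) (A x) - \<mu> z (\<mu> y (A x))"
        using rho_mu[of x z "A y"] rho_mu[of y z "A x"] by (simp_all add: algebra_simps)
      show "hom_action (sub_adjacent_bracket mul_g x y) A z
          = (hom_action x (hom_action y A) - hom_action y (hom_action x A)) z"
        using rho_bracket[of x y "A z"]
        by (simp add: hom_action_def sub_adjacent_bracket_def A.diff rv.add rv.diff mv.add mv.diff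
            mx.diff l.diff ls commute algebra_simps)
    qed
  qed
qed

lemma multilinear_curry_last_iff:
  "CE.multilinear (curry_last f) \<longleftrightarrow> (\<forall>us vs. Vector_Spaces.linear scale_g scale_v (\<lambda>x. f (us @ x # vs)))"
  (is "?M \<longleftrightarrow> ?L")
proof
  assume M: ?M
  show ?L
  proof (intro allI)
    fix us vs
    show "Vector_Spaces.linear scale_g scale_v (\<lambda>x. f (us @ x # vs))"
    proof (cases vs rule: rev_cases)
      case Nil
      then show ?thesis
        using CE.multilinear_in_W[OF M, of us] by (simp add: curry_last_def)
    next
      case (snoc ws y)
      have lc: "f (us @ (scale_g c a + b) # vs) = scale_v c (f (us @ a # vs)) + f (us @ b # vs)"
        for c a b
        using fun_cong[OF CE.multilinear_lincomb[OF M, of us c a b ws], of y]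
        by (simp add: snoc curry_last_def scale_fun_def)
      have "f (us @ 0 # vs) = 0" using lc[of 1 0 0] by simp
      then show ?thesis
        unfolding Vector_Spaces.linear_iff
        using g.vector_space_axioms V.vector_space_axioms lc[of 1] lc[of _ _ 0] by simp
    qed
  qed
next
  assume L: ?L
  show ?M
    unfolding CE.multilinear_def
  proof (intro conjI allI)
    fix xs
    show "curry_last f xs \<in> {A. Vector_Spaces.linear scale_g scale_v A}"
      using L by (simp add: curry_last_def)
  next
    fix us vs c a b
    have "f (us @ (scale_g c a + b) # ws) = scale_v c (f (us @ a # ws)) + f (us @ b # ws)" for ws
      using L by (simp add: Vector_Spaces.linear_iff)
    then show "curry_last f (us @ (scale_g c a + b) # vs)
        = scale_fun scale_v c (curry_last f (us @ a # vs)) + curry_last f (us @ b # vs)"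
      by (simp add: curry_last_def scale_fun_def fun_eq_iff)
  qed
qed

lemma multilinear_curry_last:
  "f \<in> pre_lie_cochains scale_g scale_v n \<Longrightarrow> CE.multilinear (curry_last f)"
  unfolding multilinear_curry_last_iff
  using pre_lie_cochains_linear_at[OF _ g.vector_space_axioms V.vector_space_axioms] by blast

lemma alternating_curry_last:
  assumes "f \<in> pre_lie_cochains scale_g scale_v n"
  shows "CE.alternating (curry_last f)"
  unfolding CE.alternating_def curry_last_def fun_eq_iff
proof (intro allI)
  fix us vs :: "'g list" and x y :: 'g
  let ?xs = "us @ x # x # vs @ [y]"
  have "?xs ! length us = ?xs ! Suc (length us)"
    by (simp add: nth_append)
  moreover have "Suc (length us) < length ?xs - 1" by simp
  ultimately have "f ?xs = 0"
    by (intro pre_lie_cochains_repeated[OF assms, of "length us"]) auto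
  then show "f ((us @ x # x # vs) @ [y]) = 0 y" by simp
qed

text \<open>
  Converse of \<open>multilinear_curry_last\<close> and \<open>alternating_curry_last\<close>. Degree 0 is excluded because there
  the only cochain is 0 by convention.
\<close>

lemma pre_lie_cochainsI:
  assumes "0 < n" and "\<And>xs. length xs \<noteq> n \<Longrightarrow> f xs = 0"
    and "CE.multilinear (curry_last f)" and "CE.alternating (curry_last f)"
  shows "f \<in> pre_lie_cochains scale_g scale_v n"
proof -
  have "Vector_Spaces.linear scale_g scale_v (\<lambda>x. f (xs[i := x]))"
    if "length xs = n" "i < n" for xs i
    using that assms(3) by (simp add: upd_conv_take_nth_drop multilinear_curry_last_iff)
  moreover have "f xs = 0"
    if "length xs = n" "i < j" "j < n - 1" "xs ! i = xs ! j" for xs i j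
  proof -
    define ys where "ys = butlast xs"
    have xs: "xs = ys @ [last xs]"
      unfolding ys_def using that by (intro append_butlast_last_id[symmetric]) auto
    have len: "i < length ys" "j < length ys" and eq: "ys ! i = ys ! j"
      using that by (auto simp: ys_def nth_butlast)
    have "ys = take i ys @ ys ! i # drop (Suc i) ys"
      using len by (simp add: id_take_nth_drop)
    moreover have "drop (Suc i) ys = take (j - Suc i) (drop (Suc i) ys) @ ys ! j # drop (Suc j) ys"
      using id_take_nth_drop[of "j - Suc i" "drop (Suc i) ys"] len that(2) by simp
    ultimately have "ys = take i ys @ ys ! i # take (j - Suc i) (drop (Suc i) ys) @ ys ! i # drop (Suc j) ys"
      using eq by simp
    then have "curry_last f ys = 0"
      using CE.alternating_distant[OF assms(3,4)] by metis
    then show "f xs = 0"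
      by (subst xs) (simp add: curry_last_def fun_eq_iff)
  qed
  ultimately show ?thesis
    using assms(1,2) by (auto simp: pre_lie_cochains_def)
qed

abbreviation coboundary :: "nat \<Rightarrow> ('g list \<Rightarrow> 'v) \<Rightarrow> 'g list \<Rightarrow> 'v" where
  "coboundary \<equiv> pre_lie_coboundary scale_v mul_g \<rho> \<mu>"

text \<open>
  The first three sums of the pre-Lie coboundary are the three terms of the action on \<open>Hom(g, V)\<close>,
  and the last is the bracket sum of the Chevalley--Eilenberg differential. On lists of the wrong
  length both sides are 0.
\<close>

theorem curry_last_coboundary:
  assumes "f \<in> pre_lie_cochains scale_g scale_v n"
  shows "curry_last (coboundary n f) = CE.differential (curry_last f)"
proof (intro ext)
  fix xs y
  show "curry_last (coboundary n f) xs y = CE.differential (curry_last f) xs y"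
  proof (cases "length xs = n")
    case True
    have omit: "nths (xs @ [y]) (- {i, n}) = nths xs (- {i})"
      "nths (xs @ [y]) (- {i}) = nths xs (- {i}) @ [y]" if "i < n" for i
    proof -
      have "nths xs (- {i, n}) = nths xs (- {i})"
        unfolding nths_def using True
        by (intro arg_cong[of _ _ "map fst"] filter_cong) (auto dest: set_zip_rightD)
      then show "nths (xs @ [y]) (- {i, n}) = nths xs (- {i})"
        "nths (xs @ [y]) (- {i}) = nths xs (- {i}) @ [y]"
        using that True by (simp_all add: nths_append)
    qed
    have omit2: "nths (xs @ [y]) (- {i, j}) = nths xs (- {i, j}) @ [y]" if "i < j" "j < n" for i j
      using that True by (simp add: nths_append)
    show ?thesis
      unfolding CE.differential_eq_sum[OF multilinear_curry_last[OF assms] alternating_curry_last[OF assms]]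
      using True
      by (simp add: pre_lie_coboundary_def curry_last_def sum_fun_apply scale_fun_def hom_action_def
          omit omit2 nth_append case_prod_unfold sum.distrib sum_subtractf
          V.scale_right_distrib V.scale_right_diff_distrib)
  next
    case False
    have "curry_last f ys = 0" if "Suc (length ys) = length xs" for ys
      using assms False that
      by (auto simp: pre_lie_cochains_def curry_last_def fun_eq_iff split: if_splits)
    then have "CE.differential (curry_last f) xs = 0"
      by (rule CE.differential_cong_zero)
    then show ?thesis
      using False by (simp add: curry_last_def pre_lie_coboundary_def)
  qed
qed

lemma coboundary_Nil: "coboundary n f [] = 0"
  by (simp add: pre_lie_coboundary_def)

lemma coboundary_in_cochains:
  assumes "f \<in> pre_lie_cochains scale_g scale_v n"
  shows "coboundary n f \<in> pre_lie_cochains scale_g scale_v (Suc n)"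
proof (rule pre_lie_cochainsI)
  show "coboundary n f xs = 0" if "length xs \<noteq> Suc n" for xs
    using that by (simp add: pre_lie_coboundary_def)
qed (simp_all add: curry_last_coboundary[OF assms] multilinear_curry_last[OF assms]
    alternating_curry_last[OF assms] CE.multilinear_differential CE.alternating_differential)

theorem coboundary_coboundary:
  assumes "f \<in> pre_lie_cochains scale_g scale_v n"
  shows "coboundary (Suc n) (coboundary n f) = 0"
proof (rule curry_last_inject)
  have "CE.differential (CE.differential (curry_last f)) xs = 0" for xs
    by (rule CE.differential_differential[OF multilinear_curry_last[OF assms]])
  then show "curry_last (coboundary (Suc n) (coboundary n f)) = curry_last 0"
    by (simp add: curry_last_coboundary[OF coboundary_in_cochains[OF assms]]
        curry_last_coboundary[OF assms] fun_eq_iff) (simp add: curry_last_def)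
qed (simp add: coboundary_Nil)

lemma coboundary_lincomb:
  assumes "f \<in> pre_lie_cochains scale_g scale_v n" "h \<in> pre_lie_cochains scale_g scale_v n"
  shows "coboundary n (scale_fun scale_v c f + h) = scale_fun scale_v c (coboundary n f) + coboundary n h"
proof (rule curry_last_inject)
  have c: "curry_last (scale_fun scale_v c p + q)
      = (\<lambda>xs. scale_fun scale_v c (curry_last p xs) + curry_last q xs)" for p q :: "'g list \<Rightarrow> 'v"
    by (simp add: curry_last_def scale_fun_def fun_eq_iff)
  show "curry_last (coboundary n (scale_fun scale_v c f + h))
      = curry_last (scale_fun scale_v c (coboundary n f) + coboundary n h)"
    unfolding c curry_last_coboundary[OF assms(1)] curry_last_coboundary[OF assms(2)]
      curry_last_coboundary[OF pre_lie_cochains_lincomb[OF assms V.vector_space_axioms]]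
    by (simp add: fun_eq_iff CE.differential_lincomb)
qed (simp add: coboundary_Nil scale_fun_def)

end

section \<open>The complex of a homomorphism\<close>

context pre_lie_hom
begin

sublocale rep: pre_lie_representation scale_g mul_g scale_h
  "\<lambda>x u. mul_h (\<phi> x) u" "\<lambda>x u. mul_h u (\<phi> x)"
  by (rule pre_lie_representation_hom)

sublocale reg_g: pre_lie_representation scale_g mul_g scale_g "\<lambda>x y. mul_g x y" "\<lambda>x y. mul_g y x"
  by (rule g.pre_lie_representation_regular)

sublocale reg_h: pre_lie_representation scale_h mul_h scale_h "\<lambda>x y. mul_h x y" "\<lambda>x y. mul_h y x"
  by (rule h.pre_lie_representation_regular)

lemma postcompose_in_cochains:
  assumes "f \<in> pre_lie_cochains scale_g scale_g n"
  shows "(\<lambda>xs. \<phi> (f xs)) \<in> pre_lie_cochains scale_g scale_h n"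
proof -
  interpret L: Vector_Spaces.linear scale_g scale_h \<phi> by (rule linear_hom)
  have "Vector_Spaces.linear scale_g scale_h (\<lambda>x. \<phi> (p x))"
    if "Vector_Spaces.linear scale_g scale_g p" for p
    using Vector_Spaces.linear_compose[OF that linear_hom] by (simp add: comp_def)
  then show ?thesis
    using assms unfolding pre_lie_cochains_def by (auto simp: L.zero fun_eq_iff split: if_splits)
qed

lemma precompose_in_cochains:
  assumes "f \<in> pre_lie_cochains scale_h scale_h n"
  shows "(\<lambda>xs. f (map \<phi> xs)) \<in> pre_lie_cochains scale_g scale_h n"
proof -
  have pull: "Vector_Spaces.linear scale_g scale_h (\<lambda>x. p (\<phi> x))"
    if "Vector_Spaces.linear scale_h scale_h p" for p
    using Vector_Spaces.linear_compose[OF linear_hom that] by (simp add: comp_def)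
  have "Vector_Spaces.linear scale_g scale_h (\<lambda>x. f (map \<phi> (xs[i := x])))"
    if "n \<noteq> 0" "length xs = n" "i < n" for xs i
    unfolding map_update
    by (rule pull[of "\<lambda>y. f ((map \<phi> xs)[i := y])"])
      (use assms that in \<open>simp add: pre_lie_cochains_def\<close>)
  moreover have "f (map \<phi> xs) = 0"
    if "n \<noteq> 0" "length xs = n" "i < j" "j < n - 1" "xs ! i = xs ! j" for xs i j
    by (rule pre_lie_cochains_repeated[OF assms that(3)]) (use that in simp_all)
  ultimately show ?thesis
    using assms unfolding pre_lie_cochains_def by (auto simp: fun_eq_iff split: if_splits)
qed

text \<open>
  The two naturality properties hold termwise in the explicit formula, since \<open>\<phi>\<close> is linear and
  multiplicative.
\<close>

lemma coboundary_postcompose: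
  "(\<lambda>xs. \<phi> (reg_g.coboundary n f xs)) = rep.coboundary n (\<lambda>xs. \<phi> (f xs))"
proof -
  interpret L: Vector_Spaces.linear scale_g scale_h \<phi> by (rule linear_hom)
  show ?thesis
    by (auto simp: pre_lie_coboundary_def fun_eq_iff L.add L.diff L.sum L.scale L.zero hom_mul
        case_prod_unfold)
qed

lemma coboundary_precompose:
  "(\<lambda>xs. reg_h.coboundary n f (map \<phi> xs)) = rep.coboundary n (\<lambda>xs. f (map \<phi> xs))"
proof -
  interpret L: Vector_Spaces.linear scale_g scale_h \<phi> by (rule linear_hom)
  show ?thesis
    by (auto simp: pre_lie_coboundary_def fun_eq_iff nths_map hom_mul sub_adjacent_bracket_def L.diff
        case_prod_unfold)
qed

abbreviation cochains where "cochains \<equiv> hom_cochains scale_g scale_h"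
abbreviation delta where "delta \<equiv> hom_coboundary scale_g mul_g scale_h mul_h \<phi>"

lemma delta_in_cochains:
  assumes "x \<in> cochains k"
  shows "delta k x \<in> cochains (Suc k)"
proof -
  obtain f1 f2 f3 where x: "x = (f1, f2, f3)" by (cases x)
  have f: "f1 \<in> pre_lie_cochains scale_g scale_g (Suc k)" "f2 \<in> pre_lie_cochains scale_h scale_h (Suc k)"
    "f3 \<in> pre_lie_cochains scale_g scale_h k"
    using assms by (simp_all add: x hom_cochains_def)
  interpret F: vector_space "scale_fun scale_h"
    by (rule vector_space_scale_fun[OF h.vector_space_axioms])
  note sub = subspace_pre_lie_cochains[OF g.vector_space_axioms h.vector_space_axioms, of "Suc k"]
  show ?thesis
    using reg_g.coboundary_in_cochains[OF f(1)] reg_h.coboundary_in_cochains[OF f(2)]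
      F.subspace_add[OF sub rep.coboundary_in_cochains[OF f(3)]
        F.subspace_scale[OF sub F.subspace_diff[OF sub postcompose_in_cochains[OF f(1)] precompose_in_cochains[OF f(2)]]]]
    by (simp add: x hom_cochains_def hom_coboundary_def)
qed

text \<open>
  By naturality of the coboundary, the third component is
  \<open>d\<^sub>\<phi> (d\<^sub>\<phi> f\<^sub>3 + (-1)\<^sup>k u) + (-1)\<^sup>k\<^sup>+\<^sup>1 d\<^sub>\<phi> u\<close> with \<open>u = \<phi> \<circ> f\<^sub>1 - \<phi>\<^sup>* \<circ> f\<^sub>2\<close>.
\<close>

lemma delta_delta:
  assumes "x \<in> cochains k"
  shows "delta (Suc k) (delta k x) = 0"
proof -
  obtain f1 f2 f3 where x: "x = (f1, f2, f3)" by (cases x)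
  have f: "f1 \<in> pre_lie_cochains scale_g scale_g (Suc k)" "f2 \<in> pre_lie_cochains scale_h scale_h (Suc k)"
    "f3 \<in> pre_lie_cochains scale_g scale_h k"
    using assms by (simp_all add: x hom_cochains_def)
  interpret F: vector_space "scale_fun scale_h"
    by (rule vector_space_scale_fun[OF h.vector_space_axioms])
  note push = postcompose_in_cochains[OF f(1)] and pull = precompose_in_cochains[OF f(2)]
  define u where "u = (\<lambda>xs. \<phi> (f1 xs)) - (\<lambda>xs. f2 (map \<phi> xs))"
  have u_eq: "u = scale_fun scale_h (-1) (\<lambda>xs. f2 (map \<phi> xs)) + (\<lambda>xs. \<phi> (f1 xs))"
    by (simp add: u_def)
  have u: "u \<in> pre_lie_cochains scale_g scale_h (Suc k)"
    unfolding u_eq by (rule pre_lie_cochains_lincomb[OF pull push h.vector_space_axioms])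
  have du: "rep.coboundary (Suc k) u
      = (\<lambda>xs. \<phi> (reg_g.coboundary (Suc k) f1 xs)) - (\<lambda>xs. reg_h.coboundary (Suc k) f2 (map \<phi> xs))"
    unfolding u_eq rep.coboundary_lincomb[OF pull push] coboundary_postcompose coboundary_precompose by simp
  have "rep.coboundary (Suc k) (rep.coboundary k f3 + scale_fun scale_h ((-1) ^ k) u)
      = scale_fun scale_h ((-1) ^ k) (rep.coboundary (Suc k) u)"
    using rep.coboundary_lincomb[OF u rep.coboundary_in_cochains[OF f(3)], of "(-1) ^ k"]
    by (simp add: rep.coboundary_coboundary[OF f(3)] add.commute)
  then show ?thesis
    by (simp add: x hom_coboundary_def reg_g.coboundary_coboundary[OF f(1)]
        reg_h.coboundary_coboundary[OF f(2)] zero_prod_def flip: u_def) (simp add: du)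
qed

lemma delta_lincomb:
  assumes "x \<in> cochains k" "y \<in> cochains k"
  shows "delta k (scale_hom_cochains scale_g scale_h c x + y)
     = scale_hom_cochains scale_g scale_h c (delta k x) + delta k y"
proof -
  obtain f1 f2 f3 e1 e2 e3 where x: "x = (f1, f2, f3)" and y: "y = (e1, e2, e3)"
    by (cases x; cases y)
  have f: "f1 \<in> pre_lie_cochains scale_g scale_g (Suc k)" "f2 \<in> pre_lie_cochains scale_h scale_h (Suc k)"
    "f3 \<in> pre_lie_cochains scale_g scale_h k"
    "e1 \<in> pre_lie_cochains scale_g scale_g (Suc k)" "e2 \<in> pre_lie_cochains scale_h scale_h (Suc k)"
    "e3 \<in> pre_lie_cochains scale_g scale_h k"
    using assms by (simp_all add: x y hom_cochains_def)
  interpret L: Vector_Spaces.linear scale_g scale_h \<phi> by (rule linear_hom)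
  interpret F: vector_space "scale_fun scale_h"
    by (rule vector_space_scale_fun[OF h.vector_space_axioms])
  have "scale_fun scale_h ((-1) ^ k) ((\<lambda>xs. \<phi> ((scale_fun scale_g c f1 + e1) xs))
        - (\<lambda>xs. (scale_fun scale_h c f2 + e2) (map \<phi> xs)))
      = scale_fun scale_h c (scale_fun scale_h ((-1) ^ k) ((\<lambda>xs. \<phi> (f1 xs)) - (\<lambda>xs. f2 (map \<phi> xs))))
        + scale_fun scale_h ((-1) ^ k) ((\<lambda>xs. \<phi> (e1 xs)) - (\<lambda>xs. e2 (map \<phi> xs)))"
    by (simp add: scale_fun_def fun_eq_iff L.add L.scale h.scale_right_distrib
        h.scale_right_diff_distrib mult.commute)
  then show ?thesis
    by (simp add: x y hom_coboundary_def scale_hom_cochains_def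
        reg_g.coboundary_lincomb[OF f(1,4)] reg_h.coboundary_lincomb[OF f(2,5)]
        rep.coboundary_lincomb[OF f(3,6)] F.scale_right_distrib)
qed

lemma vector_space_scale_hom_cochains: "vector_space (scale_hom_cochains scale_g scale_h)"
  by unfold_locales
    (auto simp: scale_hom_cochains_def scale_fun_def fun_eq_iff g.scale_right_distrib
      h.scale_right_distrib g.scale_left_distrib h.scale_left_distrib)

theorem cochain_complex_delta: "cochain_complex (scale_hom_cochains scale_g scale_h) cochains delta"
proof -
  interpret P: vector_space "scale_hom_cochains scale_g scale_h"
    by (rule vector_space_scale_hom_cochains)
  interpret Fg: vector_space "scale_fun scale_g"
    by (rule vector_space_scale_fun[OF g.vector_space_axioms])
  interpret Fh: vector_space "scale_fun scale_h"
    by (rule vector_space_scale_fun[OF h.vector_space_axioms])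
  have sub: "P.subspace (cochains k)" for k
    using subspace_pre_lie_cochains[OF g.vector_space_axioms g.vector_space_axioms, of "Suc k"]
      subspace_pre_lie_cochains[OF h.vector_space_axioms h.vector_space_axioms, of "Suc k"]
      subspace_pre_lie_cochains[OF g.vector_space_axioms h.vector_space_axioms, of k]
    unfolding P.subspace_def Fg.subspace_def Fh.subspace_def
    by (auto simp: hom_cochains_def scale_hom_cochains_def zero_prod_def)
  have zero: "delta k 0 = 0" for k
    using delta_lincomb[OF P.subspace_0[OF sub] P.subspace_0[OF sub], of k 1] by simp
  show ?thesis
  proof unfold_locales
    fix x y k a
    assume x: "x \<in> cochains k"
    show "delta k (scale_hom_cochains scale_g scale_h a x)
        = scale_hom_cochains scale_g scale_h a (delta k x)"
      using delta_lincomb[OF x P.subspace_0[OF sub], of a] by (simp add: zero)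
    show "delta k x \<in> cochains (Suc k)" by (rule delta_in_cochains[OF x])
    show "delta (Suc k) (delta k x) = 0" by (rule delta_delta[OF x])
    assume y: "y \<in> cochains k"
    show "delta k (x + y) = delta k x + delta k y"
      using delta_lincomb[OF x y, of 1] by simp
  qed (rule sub)
qed

end

theorem proposition3p2:
  fixes scale_g :: "'k::{alg_closed_field, field_char_0} \<Rightarrow> 'g::ab_group_add \<Rightarrow> 'g"
    and mul_g :: "'g \<Rightarrow> 'g \<Rightarrow> 'g"
    and scale_h :: "'k \<Rightarrow> 'h::ab_group_add \<Rightarrow> 'h"
    and mul_h :: "'h \<Rightarrow> 'h \<Rightarrow> 'h"
    and \<phi> :: "'g \<Rightarrow> 'h"
  assumes "pre_lie_algebra scale_g mul_g"
    and "pre_lie_algebra scale_h mul_h"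
    and "pre_lie_hom scale_g mul_g scale_h mul_h \<phi>"
  shows "(\<forall>k. \<forall>c \<in> hom_cochains scale_g scale_h k.
            hom_coboundary scale_g mul_g scale_h mul_h \<phi> (Suc k)
              (hom_coboundary scale_g mul_g scale_h mul_h \<phi> k c) = 0) \<and>
         cochain_complex (scale_hom_cochains scale_g scale_h)
           (hom_cochains scale_g scale_h)
           (hom_coboundary scale_g mul_g scale_h mul_h \<phi>)"
  using pre_lie_hom.cochain_complex_delta[OF assms(3)] pre_lie_hom.delta_delta[OF assms(3)]
  by blast

end
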